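(* Let $Z$ be a Hausdorff topological vector space and let $X$ be a nonempty compact convex subset of a topological vector space $E$. Let $C\subset Z$ be a pointed closed convex cone with nonempty interior and let $K:X\rightrightarrows X$ and $f:X\times X\rightrightarrows Z$ be correspondences with nonempty values. Let $A=\{x\in X:\text{ there exists }u\in K(x)\text{ such that }f(x,u)\subseteq -\operatorname{int}C\}$. Assume that: (i) $K$ is open valued and for each $(x,y)\in X\times X$ with the property that $f(x,y)\subseteq -\operatorname{int}C$, there exists $z=z_{x,y}\in X$ such that $y\in \operatorname{int}_X\{u\in X: f(z_{x,y},u)\subseteq -\operatorname{int}C\}$ (the points $z_{x,y}$ being fixed in what follows); (ii) $f(x,x)\nsubseteq -\operatorname{int}C$ for each $x\in X$; (iii) there exists $M\in\langle X\rangle$ such that $$\bigcup_{x\in M\cap A}\Bigl[\bigcup_{y\in K(x),\ f(x,y)\subseteq -\operatorname{int}C}\bigl(\operatorname{int}_X\{u\in X: f(z_{x,y},u)\subseteq -\operatorname{int}C\}\cap K(x)\bigr)\Bigr]\ \cup\ \bigcup_{x\in M\setminus A}K(x)=X;$$ (iv) for each $u\in X$, the set $\{x\in X: f(x,u)\subseteq -\operatorname{int}C\}\cup[(X\setminus A)\cap K^{-1}(u)]$ is convex; (v) for each $x\in A$, $$\bigcup_{y\in K(x),\ f(x,y)\subseteq -\operatorname{int}C}\operatorname{int}_X\{u\in X: f(z_{x,y},u)\subseteq -\operatorname{int}C\}\subset\{u\in X: f(x,u)\subseteq -\operatorname{int}C\}.$$ Then there exists $x^{*}\in X$ such that $x^{*}\in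 K(x^{*})$ and $f(x^{*},y)\nsubseteq -\operatorname{int}C$ for each $y\in K(x^{*})$.
   Context: A correspondence $T:X\rightrightarrows Y$ is a set-valued map assigning to each $x\in X$ a subset $T(x)\subseteq Y$. $K^{-1}(u)=\{x\in X: u\in K(x)\}$. $\langle X\rangle$ denotes the class of all nonempty finite subsets of $X$. Openness of subsets of $X$ is in the subspace topology of $X$, $\operatorname{int}_X$ is the interior relative to $X$, and $\operatorname{int}C$ is the interior of $C$ in $Z$. *)

theory Defs
  imports "HOL-Analysis.Analysis"
begin

text \<open>
  Topological vector spaces over the reals. No separation axiom is included; the Hausdorff case
  is the sort \<open>{topological_real_vector, t2_space}\<close>.
\<close>

class topological_real_vector = topological_ab_group_add + real_vector +
  assumes tendsto_scaleR_nhds: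
    "((\<lambda>p. fst p *\<^sub>R snd p) \<longlongrightarrow> c *\<^sub>R a) (nhds c \<times>\<^sub>F nhds a)"

instance real_normed_vector \<subseteq> topological_real_vector
proof
  fix c :: real and a :: 'a
  have "((\<lambda>p. fst p *\<^sub>R snd p) \<longlongrightarrow> c *\<^sub>R a) (nhds (c, a))"
    using tendsto_scaleR[OF tendsto_fst tendsto_snd, OF filterlim_ident filterlim_ident, of "(c, a)"]
    by simp
  then show "((\<lambda>p. fst p *\<^sub>R snd p) \<longlongrightarrow> c *\<^sub>R a) (nhds c \<times>\<^sub>F nhds a)"
    by (simp add: nhds_prod)
qed

definition pointed :: "'a::real_vector set \<Rightarrow> bool"
  where "pointed C \<longleftrightarrow> C \<inter> uminus ` C = {0}"

definition neg_interior :: "'z::topological_real_vector set \<Rightarrow> 'z set"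
  where "neg_interior C = uminus ` interior C"

text \<open>
  A correspondence from \<open>X\<close> to \<open>Y\<close> is a set-valued function, only its values
  at points of \<open>X\<close> being relevant.
\<close>

definition correspondence :: "'a set \<Rightarrow> 'b set \<Rightarrow> ('a \<Rightarrow> 'b set) \<Rightarrow> bool"
  where "correspondence X Y T \<longleftrightarrow> (\<forall>x\<in>X. T x \<subseteq> Y)"

definition nonempty_valued :: "'a set \<Rightarrow> ('a \<Rightarrow> 'b set) \<Rightarrow> bool"
  where "nonempty_valued X T \<longleftrightarrow> (\<forall>x\<in>X. T x \<noteq> {})"

definition open_valued :: "'a set \<Rightarrow> 'b::topological_space set \<Rightarrow> ('a \<Rightarrow> 'b set) \<Rightarrow> bool"
  where "open_valued X Y T \<longleftrightarrow> (\<forall>x\<in>X. openin (top_of_set Y) (T x))"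

definition inverse_value :: "'a set \<Rightarrow> ('a \<Rightarrow> 'b set) \<Rightarrow> 'b \<Rightarrow> 'a set"
  where "inverse_value X T u = {x \<in> X. u \<in> T x}"

end

theory Submission
  imports Defs
begin

text \<open>
  For \<open>x \<in> X\<close> let \<open>P x = {u \<in> X. f (x, u) \<subseteq> - int C}\<close>, and let \<open>Q x\<close> be the set contributed
  by \<open>x\<close> to the covering condition: the union of the relative interiors intersected with \<open>K x\<close> if
  \<open>x \<in> A\<close>, and \<open>K x\<close> otherwise. The sets \<open>Q x\<close> are open in \<open>X\<close>, and finitely many of them cover \<open>X\<close>.
  By the inclusion assumed for the points of \<open>A\<close>, \<open>u \<in> Q x\<close> implies \<open>x \<in> S u\<close>, where
  \<open>S u = {x. u \<in> P x} \<union> {x \<in> X - A. u \<in> K x}\<close> is convex by assumption. It suffices to find \<open>u\<close> with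
  \<open>u \<in> S u\<close>: since \<open>f (u, u) \<subseteq> - int C\<close> is excluded, such a \<open>u\<close> lies outside \<open>A\<close> and in \<open>K u\<close>, and
  being outside \<open>A\<close> is the remaining part of the conclusion.

  The point \<open>u\<close> comes from a form of the Knaster-Kuratowski-Mazurkiewicz principle
  (\<open>open_cover_imp_convex_hull_point\<close>): if finitely many sets \<open>Q\<^sub>i\<close>, open in a nonempty convex set, cover it, then for
  any points \<open>v\<^sub>i\<close> of that set some \<open>u\<close> lies in the convex hull of those \<open>v\<^sub>i\<close> with \<open>u \<in> Q\<^sub>i\<close>. The ambient
  topological vector space need not be Hausdorff, so the cover may have no subordinate partition of
  unity. It is therefore pulled back along \<open>t \<mapsto> \<Sum>\<^sub>i t\<^sub>i v\<^sub>i\<close> to a simplex. There a partition of unity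
  \<open>(\<phi>\<^sub>i)\<close> subordinate to the pulled back cover exists, and a fixed point of \<open>t \<mapsto> (\<phi>\<^sub>i t)\<^sub>i\<close> yields \<open>u\<close>.
  The number of sets is not fixed in advance, so Brouwer's theorem is needed in
  \<open>\<real>\<^sup>n\<close> for a variable \<open>n\<close> (\<open>brouwer_unit_cube\<close>); it is derived from Kuhn's combinatorial lemma.
\<close>

section \<open>Brouwer's theorem in variable dimension\<close>

text \<open>
  The \<open>n\<close>-dimensional unit cube, as a set of real sequences that vanish from index \<open>n\<close> on. This
  encoding makes the dimension a number instead of a type, with the product topology on
  \<open>nat \<Rightarrow> real\<close> restricting to the usual topology of the cube.
\<close>

definition unit_cube :: "nat \<Rightarrow> (nat \<Rightarrow> real) set"
  where "unit_cube n = {x. (\<forall>i<n. 0 \<le> x i \<and> x i \<le> 1) \<and> (\<forall>i\<ge>n. x i = 0)}"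

lemma compact_unit_cube: "compact (unit_cube n)"
proof -
  have eq: "unit_cube n = (\<Pi>\<^sub>E i\<in>UNIV. if i < n then {0..1} else {0})"
    by (auto simp: unit_cube_def PiE_UNIV_domain Pi_def not_less split: if_splits)
  have "compactin (product_topology (\<lambda>_. euclidean) UNIV)
      (\<Pi>\<^sub>E i\<in>UNIV. if i < n then {0..1::real} else {0})"
    by (subst compactin_PiE) auto
  then show ?thesis
    by (simp add: eq euclidean_product_topology)
qed

lemma tendsto_fun_iff:
  "(f \<longlongrightarrow> l) F \<longleftrightarrow> (\<forall>i. ((\<lambda>c. f c i) \<longlongrightarrow> l i) F)"
  for f :: "'c \<Rightarrow> 'a \<Rightarrow> 'b::topological_space"
  using limitin_componentwise [of "\<lambda>_. euclidean" UNIV f l F]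
  by (simp add: euclidean_product_topology)

theorem brouwer_unit_cube:
  assumes cont: "continuous_on (unit_cube n) F"
    and F: "\<And>x. x \<in> unit_cube n \<Longrightarrow> F x \<in> unit_cube n"
  obtains x where "x \<in> unit_cube n" "F x = x"
proof -
  \<comment> \<open>Kuhn's lemma on the grid of mesh \<open>1 / Suc p\<close> yields a point near which, for every \<open>i\<close>, the
    \<open>i\<close>-th coordinate of \<open>F y - y\<close> takes both signs. A limit point of these as \<open>p\<close> grows is fixed.\<close>
  have "\<exists>x\<in>unit_cube n. \<exists>a b. \<forall>i<n. a i \<in> unit_cube n \<and> b i \<in> unit_cube n \<and>
      (\<forall>j. \<bar>a i j - x j\<bar> \<le> 1 / Suc p \<and> \<bar>b i j - x j\<bar> \<le> 1 / Suc p) \<and>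
      a i i \<le> F (a i) i \<and> F (b i) i \<le> b i i" for p
  proof -
    define g :: "(nat \<Rightarrow> nat) \<Rightarrow> nat \<Rightarrow> real"
      where "g y i = (if i < n then y i / Suc p else 0)" for y i
    \<comment> \<open>Label 0 says that \<open>F\<close> does not decrease coordinate \<open>i\<close>, label 1 that it does not increase it.
      Both hold if there is equality, which leaves room for the values that Kuhn's lemma
      prescribes on the faces of the cube.\<close>
    define label :: "(nat \<Rightarrow> nat) \<Rightarrow> nat \<Rightarrow> nat"
      where "label y i = (if y i = 0 \<or> (y i \<noteq> Suc p \<and> g y i \<le> F (g y) i) then 0 else 1)" for y i
    have g: "g y \<in> unit_cube n" if "\<forall>i<n. y i \<le> Suc p" for y
      using that by (auto simp: unit_cube_def g_def divide_simps)
    have label0: "g y i \<le> F (g y) i" if y: "\<forall>i<n. y i \<le> Suc p" "i < n" "label y i = 0" for y i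
      using that F[OF g[OF y(1)]] by (auto simp: label_def g_def unit_cube_def split: if_splits)
    have label1: "F (g y) i \<le> g y i" if y: "\<forall>i<n. y i \<le> Suc p" "i < n" "label y i \<noteq> 0" for y i
      using that F[OF g[OF y(1)]] by (auto simp: label_def g_def unit_cube_def split: if_splits)
    obtain q where q: "\<forall>i<n. q i < Suc p"
      and sep: "\<forall>i<n. \<exists>r s. (\<forall>j<n. q j \<le> r j \<and> r j \<le> q j + 1)
        \<and> (\<forall>j<n. q j \<le> s j \<and> s j \<le> q j + 1) \<and> label r i \<noteq> label s i"
      by (rule kuhn_lemma[of "Suc p" n label]) (auto simp: label_def)
    have near: "g y \<in> unit_cube n \<and> (\<forall>j. \<bar>g y j - g q j\<bar> \<le> 1 / Suc p) \<and> (\<forall>i<n. y i \<le> Suc p)"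
      if "\<forall>j<n. q j \<le> y j \<and> y j \<le> q j + 1" for y
    proof -
      have le: "\<forall>i<n. y i \<le> Suc p"
        using that q by (metis Suc_eq_plus1 Suc_leI le_trans)
      have "\<bar>g y j - g q j\<bar> \<le> 1 / Suc p" for j
      proof (cases "j < n")
        case True
        then have "\<bar>real (y j) - real (q j)\<bar> \<le> 1"
          using that by force
        then show ?thesis
          using True by (simp add: g_def flip: diff_divide_distrib) (simp add: divide_right_mono)
      qed (simp add: g_def)
      then show ?thesis using le g by blast
    qed
    have "\<exists>a b. a \<in> unit_cube n \<and> b \<in> unit_cube n \<and>
      (\<forall>j. \<bar>a j - g q j\<bar> \<le> 1 / Suc p \<and> \<bar>b j - g q j\<bar> \<le> 1 / Suc p) \<and>
      a i \<le> F a i \<and> F b i \<le> b i" if i: "i < n" for i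
    proof -
      obtain r s where r: "\<forall>j<n. q j \<le> r j \<and> r j \<le> q j + 1"
        and s: "\<forall>j<n. q j \<le> s j \<and> s j \<le> q j + 1" and ne: "label r i \<noteq> label s i"
        using sep i by blast
      show ?thesis
      proof (cases "label r i = 0")
        case True
        then show ?thesis
          using near[OF r] near[OF s] label0[OF _ i, of r] label1[OF _ i, of s] ne
          by (intro exI[of _ "g r"] exI[of _ "g s"]) auto
      next
        case False
        then have "label s i = 0"
          using ne by (auto simp: label_def split: if_splits)
        then show ?thesis
          using near[OF r] near[OF s] label0[OF _ i, of s] label1[OF _ i, of r] False
          by (intro exI[of _ "g s"] exI[of _ "g r"]) auto
      qed
    qed
    then obtain a b where "\<forall>i<n. a i \<in> unit_cube n \<and> b i \<in> unit_cube n \<and>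
      (\<forall>j. \<bar>a i j - g q j\<bar> \<le> 1 / Suc p \<and> \<bar>b i j - g q j\<bar> \<le> 1 / Suc p) \<and>
      a i i \<le> F (a i) i \<and> F (b i) i \<le> b i i"
      by metis
    moreover have "g q \<in> unit_cube n"
      using q by (intro g) auto
    ultimately show ?thesis
      by blast
  qed
  then obtain x a b where x: "\<And>p. x p \<in> unit_cube n"
    and ab: "\<And>p i. i < n \<Longrightarrow> a p i \<in> unit_cube n \<and> b p i \<in> unit_cube n \<and>
      (\<forall>j. \<bar>a p i j - x p j\<bar> \<le> 1 / Suc p \<and> \<bar>b p i j - x p j\<bar> \<le> 1 / Suc p) \<and>
      a p i i \<le> F (a p i) i \<and> F (b p i) i \<le> b p i i"
    by metis
  have "seq_compact (unit_cube n)"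
    by (intro compact_imp_seq_compact compact_unit_cube)
  then obtain l r where l: "l \<in> unit_cube n" and r: "strict_mono r" and xl: "(x \<circ> r) \<longlonglongrightarrow> l"
    using x unfolding seq_compact_def by metis
  have r0: "(\<lambda>k. 1 / real (Suc (r k))) \<longlonglongrightarrow> 0"
    using LIMSEQ_subseq_LIMSEQ[OF LIMSEQ_inverse_real_of_nat r] by (simp add: o_def divide_inverse)
  have lim: "c \<longlonglongrightarrow> l" if "\<And>k j. \<bar>c k j - x (r k) j\<bar> \<le> 1 / Suc (r k)" for c
    unfolding tendsto_fun_iff
  proof
    fix j
    have "(\<lambda>k. c k j - x (r k) j) \<longlonglongrightarrow> 0"
      by (rule Lim_null_comparison[OF _ r0]) (use that in auto)
    moreover have "(\<lambda>k. x (r k) j) \<longlonglongrightarrow> l j"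
      using xl by (simp add: tendsto_fun_iff)
    ultimately show "(\<lambda>k. c k j) \<longlonglongrightarrow> l j"
      using tendsto_add by force
  qed
  have limF: "(\<lambda>k. F (c k) i) \<longlonglongrightarrow> F l i" if "c \<longlonglongrightarrow> l" "\<And>k. c k \<in> unit_cube n" for c i
    using continuous_on_tendsto_compose[OF cont that(1) l] that(2) by (simp add: tendsto_fun_iff)
  have "F l i = l i" for i
  proof (cases "i < n")
    case True
    have a: "(\<lambda>k. a (r k) i) \<longlonglongrightarrow> l" and b: "(\<lambda>k. b (r k) i) \<longlonglongrightarrow> l"
      using ab[OF True] by (auto intro!: lim)
    have "l i \<le> F l i"
      by (rule LIMSEQ_le[of "\<lambda>k. a (r k) i i" _ "\<lambda>k. F (a (r k) i) i"])
        (use a limF[OF a] ab[OF True] in \<open>auto simp: tendsto_fun_iff\<close>)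
    moreover have "F l i \<le> l i"
      by (rule LIMSEQ_le[of "\<lambda>k. F (b (r k) i) i" _ "\<lambda>k. b (r k) i i"])
        (use b limF[OF b] ab[OF True] in \<open>auto simp: tendsto_fun_iff\<close>)
    ultimately show ?thesis by simp
  next
    case False
    then show ?thesis
      using l F[OF l] by (simp add: unit_cube_def)
  qed
  then show ?thesis
    using that[OF l] by blast
qed

section \<open>Open covers of convex sets\<close>

lemma continuous_on_scaleR_tvs:
  fixes g :: "'a::topological_space \<Rightarrow> real" and v :: "'e::topological_real_vector"
  assumes "continuous_on S g"
  shows "continuous_on S (\<lambda>x. g x *\<^sub>R v)"
  unfolding continuous_on_def
proof
  fix x assume "x \<in> S"
  then have "(g \<longlongrightarrow> g x) (at x within S)"
    using assms by (simp add: continuous_on_def)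
  then have "filterlim (\<lambda>y. (g y, v)) (nhds (g x) \<times>\<^sub>F nhds v) (at x within S)"
    by (intro filterlim_Pair tendsto_const)
  from filterlim_compose[OF tendsto_scaleR_nhds this]
  show "((\<lambda>x. g x *\<^sub>R v) \<longlongrightarrow> g x *\<^sub>R v) (at x within S)"
    by simp
qed

text \<open>An open set in a metric space is the positivity set of a nonnegative continuous function.\<close>

lemma openin_positivity_set:
  fixes T :: "'a::metric_space set"
  assumes "openin (top_of_set T) U"
  obtains g :: "'a \<Rightarrow> real"
  where "continuous_on T g" "\<And>x. 0 \<le> g x" "\<And>x. x \<in> T \<Longrightarrow> 0 < g x \<longleftrightarrow> x \<in> U"
proof -
  obtain V where V: "open V" "U = T \<inter> V"
    using assms by (auto simp: openin_open)
  show ?thesis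
  proof (cases "V = UNIV")
    case True
    then show ?thesis
      using that[of "\<lambda>_. 1"] V by auto
  next
    case False
    then have "0 < infdist x (- V) \<longleftrightarrow> x \<in> V" for x
      using in_closed_iff_infdist_zero[of "- V" x] infdist_nonneg[of x "- V"] V(1)
      by (auto simp: less_le closed_Compl)
    then show ?thesis
      using V by (intro that[of "\<lambda>x. infdist x (- V)"]) (auto intro!: continuous_intros infdist_nonneg)
  qed
qed

theorem open_cover_imp_convex_hull_point:
  fixes X :: "'e::topological_real_vector set" and v :: "nat \<Rightarrow> 'e" and Q :: "nat \<Rightarrow> 'e set"
  assumes "convex X" "X \<noteq> {}"
    and v: "\<And>i. i < n \<Longrightarrow> v i \<in> X"
    and Q: "\<And>i. i < n \<Longrightarrow> openin (top_of_set X) (Q i)"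
    and cover: "X \<subseteq> (\<Union>i<n. Q i)"
  obtains u where "u \<in> X" "u \<in> convex hull (v ` {i. i < n \<and> u \<in> Q i})"
proof -
  have n: "0 < n"
    using cover \<open>X \<noteq> {}\<close> by (cases n) auto
  \<comment> \<open>\<open>w\<close> maps the cube to the simplex of weights and fixes every point of that simplex. The
    correction \<open>c t\<close> keeps the total weight \<open>W t\<close> positive when the coordinates sum to less than 1.\<close>
  define c :: "(nat \<Rightarrow> real) \<Rightarrow> real" where "c t = max 0 (1 - (\<Sum>i<n. t i))" for t
  define W where "W t = (\<Sum>i<n. t i + c t)" for t
  define w where "w t i = (t i + c t) / W t" for t i
  define u where "u t = (\<Sum>i<n. w t i *\<^sub>R v i)" for t
  have W: "1 \<le> W t" for t
  proof -
    have "c t \<le> n * c t"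
      using n by (simp add: c_def mult_le_cancel_right1)
    then show ?thesis
      unfolding W_def sum.distrib by (simp add: c_def)
  qed
  have w_sum: "(\<Sum>i<n. w t i) = 1" for t
    using W[of t] by (simp add: w_def W_def flip: sum_divide_distrib)
  have w_nonneg: "0 \<le> w t i" if "t \<in> unit_cube n" "i < n" for t i
    using that W[of t] by (auto simp: w_def c_def unit_cube_def)
  have uX: "u t \<in> X" if "t \<in> unit_cube n" for t
    unfolding u_def using that by (intro convex_sum \<open>convex X\<close> w_sum w_nonneg v) auto
  have coord: "continuous_on (unit_cube n) (\<lambda>t. t i)" for i
    by (rule continuous_on_subset[OF continuous_on_product_coordinates]) simp
  have cont_c: "continuous_on (unit_cube n) c"
    unfolding c_def by (intro continuous_intros coord)
  have "continuous_on (unit_cube n) (\<lambda>t. w t i)" for i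
    unfolding w_def
  proof (intro continuous_intros coord cont_c ballI)
    show "continuous_on (unit_cube n) W"
      unfolding W_def by (intro continuous_intros coord cont_c)
    show "W t \<noteq> 0" for t
      using W[of t] by simp
  qed
  then have cont_u: "continuous_on (unit_cube n) u"
    unfolding u_def by (intro continuous_on_sum continuous_on_scaleR_tvs)
  have "\<exists>g :: (nat \<Rightarrow> real) \<Rightarrow> real. continuous_on (unit_cube n) g \<and> (\<forall>t. 0 \<le> g t) \<and>
      (\<forall>t\<in>unit_cube n. 0 < g t \<longleftrightarrow> u t \<in> Q i)" if "i < n" for i
  proof -
    have "openin (top_of_set (unit_cube n)) (unit_cube n \<inter> u -` Q i)"
      using continuous_openin_preimage[OF cont_u _ Q[OF that]] uX by blast
    then show ?thesis
      by (rule openin_positivity_set) blast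
  qed
  then obtain g :: "nat \<Rightarrow> (nat \<Rightarrow> real) \<Rightarrow> real"
    where cont_g: "\<And>i. i < n \<Longrightarrow> continuous_on (unit_cube n) (g i)"
      and g_nonneg: "\<And>i t. i < n \<Longrightarrow> 0 \<le> g i t"
      and g_pos: "\<And>i t. i < n \<Longrightarrow> t \<in> unit_cube n \<Longrightarrow> 0 < g i t \<longleftrightarrow> u t \<in> Q i"
    by metis
  define G where "G t = (\<Sum>i<n. g i t)" for t
  define \<phi> where "\<phi> t i = (if i < n then g i t / G t else 0)" for t i
  have G_pos: "0 < G t" if t: "t \<in> unit_cube n" for t
  proof -
    obtain i where "i < n" "u t \<in> Q i"
      using cover uX[OF t] by auto
    then show ?thesis
      unfolding G_def using g_pos[OF _ t] g_nonneg by (intro sum_pos2[of _ i]) auto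
  qed
  have \<phi>_sum: "(\<Sum>i<n. \<phi> t i) = 1" if "t \<in> unit_cube n" for t
    using G_pos[OF that] by (simp add: \<phi>_def G_def flip: sum_divide_distrib)
  have \<phi>_nonneg: "0 \<le> \<phi> t i" if "t \<in> unit_cube n" for t i
    using G_pos[OF that] g_nonneg by (simp add: \<phi>_def)
  have "\<phi> t \<in> unit_cube n" if t: "t \<in> unit_cube n" for t
  proof -
    have "\<phi> t i \<le> 1" if "i < n" for i
      using member_le_sum[of i "{..<n}" "\<phi> t"] that \<phi>_nonneg[OF t] \<phi>_sum[OF t] by simp
    then show ?thesis
      using \<phi>_nonneg[OF t] by (simp add: unit_cube_def) (simp add: \<phi>_def)
  qed
  moreover have "continuous_on (unit_cube n) \<phi>"
  proof (rule continuous_on_coordinatewise_then_product)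
    fix i
    show "continuous_on (unit_cube n) (\<lambda>t. \<phi> t i)"
    proof (cases "i < n")
      case True
      have "continuous_on (unit_cube n) G"
        unfolding G_def by (intro continuous_intros cont_g) auto
      then show ?thesis
        using True by (auto simp: \<phi>_def intro!: continuous_on_divide cont_g dest: G_pos)
    qed (simp add: \<phi>_def)
  qed
  ultimately obtain t where t: "t \<in> unit_cube n" "\<phi> t = t"
    using brouwer_unit_cube by blast
  \<comment> \<open>A fixed point of \<open>\<phi>\<close> has total weight 1, hence lies in the simplex on which \<open>w\<close> is the identity.\<close>
  have "w t i = t i" for i
    using \<phi>_sum[OF t(1)] by (simp add: t(2) w_def W_def c_def)
  then have u_eq: "u t = (\<Sum>i<n. t i *\<^sub>R v i)"
    by (simp add: u_def)
  define I where "I = {i. i < n \<and> u t \<in> Q i}"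
  have zero: "t i = 0" if "i \<in> {..<n} - I" for i
  proof -
    have "i < n" "\<not> 0 < g i t"
      using that g_pos[OF _ t(1)] by (auto simp: I_def)
    then have "\<phi> t i = 0"
      using g_nonneg[of i t] by (simp add: \<phi>_def)
    then show ?thesis
      by (simp add: t(2))
  qed
  have I: "finite I" "I \<subseteq> {..<n}"
    by (auto simp: I_def)
  have "(\<Sum>i\<in>I. t i) = (\<Sum>i<n. t i)"
    using zero I by (intro sum.mono_neutral_left) auto
  then have "(\<Sum>i\<in>I. t i) = 1"
    using \<phi>_sum[OF t(1)] by (simp add: t(2))
  moreover have "u t = (\<Sum>i\<in>I. t i *\<^sub>R v i)"
    unfolding u_eq using zero I by (intro sum.mono_neutral_right) auto
  moreover have "0 \<le> t i" for i
    using \<phi>_nonneg[OF t(1)] by (simp add: t(2))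
  ultimately have "u t \<in> convex hull (v ` I)"
    using convex_sum[of I "convex hull (v ` I)" t v] I by (auto intro: hull_inc)
  then show ?thesis
    using that uX[OF t(1)] by (simp add: I_def)
qed

text \<open>
  Compared with the Fan-Browder fixed point theorem, \<open>Q\<close> plays the role of the inverse images; the cover
  being finite, neither compactness of \<open>X\<close> nor a separation axiom is needed.
\<close>

corollary finite_open_cover_fixed_point:
  fixes X :: "'e::topological_real_vector set"
  assumes X: "convex X" "X \<noteq> {}"
    and M: "finite M" "M \<subseteq> X"
    and Q: "\<And>x. x \<in> M \<Longrightarrow> openin (top_of_set X) (Q x)"
    and cover: "X \<subseteq> (\<Union>x\<in>M. Q x)"
    and S: "\<And>u. u \<in> X \<Longrightarrow> convex (S u)"
    and QS: "\<And>x u. x \<in> M \<Longrightarrow> u \<in> Q x \<Longrightarrow> x \<in> S u"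
  obtains u where "u \<in> X" "u \<in> S u"
proof -
  obtain v and n :: nat where v: "M = v ` {i. i < n}"
    using finite_imp_nat_seg_image_inj_on[OF M(1)] by blast
  obtain u where u: "u \<in> X" "u \<in> convex hull (v ` {i. i < n \<and> u \<in> Q (v i)})"
  proof (rule open_cover_imp_convex_hull_point[OF X])
    show "v i \<in> X" "openin (top_of_set X) (Q (v i))" if "i < n" for i
      using that M(2) Q by (auto simp: v)
    show "X \<subseteq> (\<Union>i<n. Q (v i))"
      using cover by (auto simp: v)
  qed
  have "v ` {i. i < n \<and> u \<in> Q (v i)} \<subseteq> S u"
    using QS by (auto simp: v)
  then have "convex hull (v ` {i. i < n \<and> u \<in> Q (v i)}) \<subseteq> S u"
    using S[OF u(1)] by (rule hull_minimal)
  then show ?thesis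
    using that u by blast
qed

section \<open>Existence of a solution\<close>

theorem theorem8:
  fixes X :: "'e::topological_real_vector set"
    and C :: "'z::{topological_real_vector, t2_space} set"
    and K :: "'e \<Rightarrow> 'e set"
    and f :: "'e \<times> 'e \<Rightarrow> 'z set"
    and z :: "'e \<Rightarrow> 'e \<Rightarrow> 'e"
    and A :: "'e set"
  assumes X: "X \<noteq> {}" "compact X" "convex X"
    and C: "pointed C" "closed C" "convex_cone C" "interior C \<noteq> {}"
    and K: "correspondence X X K" "nonempty_valued X K"
    and f: "correspondence (X \<times> X) UNIV f" "nonempty_valued (X \<times> X) f"
    and A: "A = {x \<in> X. \<exists>u\<in>K x. f (x, u) \<subseteq> neg_interior C}"
    and i_open: "open_valued X X K"
    and i_z: "\<And>x y. x \<in> X \<Longrightarrow> y \<in> X \<Longrightarrow> f (x, y) \<subseteq> neg_interior C \<Longrightarrow>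
      z x y \<in> X \<and> y \<in> top_of_set X interior_of {u \<in> X. f (z x y, u) \<subseteq> neg_interior C}"
    and ii: "\<And>x. x \<in> X \<Longrightarrow> \<not> f (x, x) \<subseteq> neg_interior C"
    and iii: "\<exists>M. finite M \<and> M \<noteq> {} \<and> M \<subseteq> X \<and>
      (\<Union>x\<in>M \<inter> A. \<Union>y\<in>{y \<in> K x. f (x, y) \<subseteq> neg_interior C}.
          (top_of_set X interior_of {u \<in> X. f (z x y, u) \<subseteq> neg_interior C}) \<inter> K x)
      \<union> (\<Union>x\<in>M - A. K x) = X"
    and iv: "\<And>u. u \<in> X \<Longrightarrow>
      convex ({x \<in> X. f (x, u) \<subseteq> neg_interior C} \<union> ((X - A) \<inter> inverse_value X K u))"
    and v: "\<And>x. x \<in> A \<Longrightarrow>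
      (\<Union>y\<in>{y \<in> K x. f (x, y) \<subseteq> neg_interior C}.
          top_of_set X interior_of {u \<in> X. f (z x y, u) \<subseteq> neg_interior C})
      \<subseteq> {u \<in> X. f (x, u) \<subseteq> neg_interior C}"
  shows "\<exists>x\<in>X. x \<in> K x \<and> (\<forall>y\<in>K x. \<not> f (x, y) \<subseteq> neg_interior C)"
proof -
  define P where "P x = {u \<in> X. f (x, u) \<subseteq> neg_interior C}" for x
  define N where "N x = (\<Union>y\<in>{y \<in> K x. f (x, y) \<subseteq> neg_interior C}.
      top_of_set X interior_of P (z x y))" for x
  define Q where "Q x = (if x \<in> A then N x \<inter> K x else K x)" for x
  define S where "S u = {x \<in> X. u \<in> P x} \<union> ((X - A) \<inter> inverse_value X K u)" for u
  obtain M where M: "finite M" "M \<subseteq> X" and cover: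
    "(\<Union>x\<in>M \<inter> A. \<Union>y\<in>{y \<in> K x. f (x, y) \<subseteq> neg_interior C}.
        (top_of_set X interior_of P (z x y)) \<inter> K x) \<union> (\<Union>x\<in>M - A. K x) = X"
    using iii unfolding P_def by blast
  have "X \<subseteq> (\<Union>x\<in>M. Q x)"
    unfolding Q_def N_def by (subst cover[symmetric]) auto
  moreover have "openin (top_of_set X) (Q x)" if "x \<in> M" for x
  proof -
    have K_open: "openin (top_of_set X) (K x)"
      using i_open that M(2) by (auto simp: open_valued_def)
    moreover have "openin (top_of_set X) (N x)"
      unfolding N_def by (intro openin_Union) auto
    ultimately show ?thesis
      by (simp add: Q_def openin_Int)
  qed
  moreover have "convex (S u)" if "u \<in> X" for u
    using iv[OF that] that by (simp add: S_def P_def)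
  moreover have "x \<in> S u" if x: "x \<in> M" and u: "u \<in> Q x" for x u
  proof (cases "x \<in> A")
    case True
    then have "u \<in> N x"
      using u by (simp add: Q_def)
    then show ?thesis
      using v[OF True] x M(2) unfolding N_def S_def P_def by blast
  next
    case False
    then show ?thesis
      using x u M(2) by (auto simp: Q_def S_def inverse_value_def)
  qed
  ultimately obtain u where u: "u \<in> X" "u \<in> S u"
    using finite_open_cover_fixed_point[OF X(3) X(1) M] by metis
  have "u \<notin> P u"
    using ii[OF u(1)] by (simp add: P_def)
  then have "u \<notin> A" "u \<in> K u"
    using u by (auto simp: S_def inverse_value_def)
  then show ?thesis
    using u(1) by (auto simp: A)
qed

end
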